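(* Let $T$ be a text whose last character is a sentinel $\$$ occurring nowhere else in $T$, and let $S$ be a repeated string in $T$, i.e. $f(S)\ge 2$. Define $L(S) := \{x \in \Sigma : f(xS)\ge 2\}$ and, for any string $P$, $r(P) := \{y \in \Sigma\cup\{\$\} : f(Py) = 1\}$. Then \[ \phi(S) = |r(S)| - \sum_{x\in L(S)} |r(xS)\cap r(S)| . \]
   Context: $\Sigma$ is a constant-size alphabet not containing $\$$. For a text $T$ of length $n$, $T[i\ldots j]$ denotes the substring from position $i$ to position $j$, and for a string $P$, $f(P)$ is the number of occurrences of $P$ in $T$ (the number of starting positions $i$ with $T[i\ldots i+|P|-1]=P$). A string $P$ is unique if $f(P)=1$ and repeated if $f(P)\ge 2$. An occurrence $(i,j)$ (meaning $T[i\ldots j]$) is a net occurrence if $f(T[i\ldots j])\ge 2$, $f(T[i-1\ldots j])=1$ and $f(T[i\ldots j+1])=1$, where by convention the condition $f(T[i-1\ldots j])=1$ is considered true when $i=1$ and $f(T[i\ldots j+1])=1$ is considered true when $j=n$. The net frequency $\phi(S)$ of a string $S$ in $T$ is the number of net occurrences $(i,j)$ with $T[i\ldots j]=S$ (in particular it is $0$ for unique strings). *)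

theory Defs
  imports Main
begin

text \<open>
  Positions in a text are numbered from 1, so the substring from \<open>i\<close> to \<open>j\<close>
  (both inclusive, with \<open>i \<ge> 1\<close>) is meaningful for \<open>j \<ge> i - 1\<close>; the case
  \<open>j = i - 1\<close> is the empty string.
\<close>

definition substr :: "'a list \<Rightarrow> nat \<Rightarrow> nat \<Rightarrow> 'a list" where
  "substr T i j = take (j + 1 - i) (drop (i - 1) T)"

text \<open>
  A starting position is a position of the text. In particular the empty string has
  \<open>length T\<close> occurrences, and there is none at \<open>length T + 1\<close>.
\<close>

definition freq :: "'a list \<Rightarrow> 'a list \<Rightarrow> nat" where
  "freq T P = card {i \<in> {1..length T}.
     i + length P - 1 \<le> length T \<and> substr T i (i + length P - 1) = P}"

definition repeated :: "'a list \<Rightarrow> 'a list \<Rightarrow> bool" where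
  "repeated T P \<longleftrightarrow> freq T P \<ge> 2"

definition uniq :: "'a list \<Rightarrow> 'a list \<Rightarrow> bool" where
  "uniq T P \<longleftrightarrow> freq T P = 1"

definition net_occurrence :: "'a list \<Rightarrow> nat \<Rightarrow> nat \<Rightarrow> bool" where
  "net_occurrence T i j \<longleftrightarrow>
     1 \<le> i \<and> i \<le> length T \<and> i \<le> j + 1 \<and> j \<le> length T \<and>
     repeated T (substr T i j) \<and>
     (i = 1 \<or> uniq T (substr T (i - 1) j)) \<and>
     (j = length T \<or> uniq T (substr T i (j + 1)))"

definition net_frequency :: "'a list \<Rightarrow> 'a list \<Rightarrow> nat" where
  "net_frequency T S = card {(i, j). net_occurrence T i j \<and> substr T i j = S}"

definition repeated_left_exts :: "'a set \<Rightarrow> 'a list \<Rightarrow> 'a list \<Rightarrow> 'a set" where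
  "repeated_left_exts \<Sigma> T S = {x \<in> \<Sigma>. repeated T (x # S)}"

definition unique_right_exts :: "'a set \<Rightarrow> 'a \<Rightarrow> 'a list \<Rightarrow> 'a list \<Rightarrow> 'a set" where
  "unique_right_exts \<Sigma> d T P = {y \<in> \<Sigma> \<union> {d}. uniq T (P @ [y])}"

end

theory Submission
  imports Defs
begin

text \<open>
  A letter \<open>y\<close> with \<open>S y\<close> unique determines one occurrence of \<open>S\<close>, and that occurrence is a
  net occurrence unless it is preceded by a letter \<open>x\<close> with \<open>x S\<close> repeated. In the
  latter case \<open>x S y\<close> is unique as well, and \<open>x\<close> is determined by \<open>y\<close>; hence the sets summed
  over are disjoint, and together they are exactly the letters to be discarded. The sentinel makes
  sure that a repeated \<open>S\<close> does not end at the end of the text and is never preceded by \<open>$\<close>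
  when it has a right extension.
\<close>

text \<open>
  Occurrences are indexed from 0. The condition \<open>k < length T\<close> matters only for the empty string,
  since \<open>take\<close> returns a string that is too short if \<open>P\<close> does not fit.
\<close>

definition occs :: "'a list \<Rightarrow> 'a list \<Rightarrow> nat set" where
  "occs T P = {k. k < length T \<and> take (length P) (drop k T) = P}"

lemma finite_occs: "finite (occs T P)"
  unfolding occs_def by simp

lemma occs_length: "k \<in> occs T P \<Longrightarrow> k + length P \<le> length T"
proof -
  assume "k \<in> occs T P"
  then have "k < length T" and "take (length P) (drop k T) = P"
    by (auto simp: occs_def)
  from arg_cong[OF this(2), of length] this(1) show ?thesis
    by simp
qed

lemma substr_Suc: "substr T (Suc k) j = take (j - k) (drop k T)"
  by (simp add: substr_def)

lemma freq_eq_card_occs: "freq T P = card (occs T P)"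
proof -
  have "{i \<in> {1..length T}. i + length P - 1 \<le> length T \<and> substr T i (i + length P - 1) = P}
      = Suc ` occs T P" (is "?A = _")
  proof (intro set_eqI iffI)
    fix i
    assume "i \<in> ?A"
    then obtain k where "i = Suc k" "k < length T" "substr T (Suc k) (k + length P) = P"
      by (cases i) auto
    then show "i \<in> Suc ` occs T P"
      by (auto simp: occs_def substr_Suc)
  next
    fix i
    assume "i \<in> Suc ` occs T P"
    then obtain k where "i = Suc k" "k \<in> occs T P"
      by auto
    then show "i \<in> ?A"
      using occs_length[of k T P] by (auto simp: occs_def substr_Suc)
  qed
  then show ?thesis
    by (simp add: freq_def card_image)
qed

lemma uniq_iff: "uniq T P \<longleftrightarrow> (\<exists>k. occs T P = {k})"
  by (simp add: uniq_def freq_eq_card_occs card_1_singleton_iff)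

lemma repeated_iff_not_uniq:
  assumes "k \<in> occs T P"
  shows "repeated T P \<longleftrightarrow> \<not> uniq T P"
proof -
  have "card (occs T P) > 0"
    using assms finite_occs[of T P] by (subst card_gt_0_iff) blast
  then show ?thesis
    by (auto simp: repeated_def uniq_def freq_eq_card_occs)
qed

lemma occs_snoc:
  "k \<in> occs T (P @ [y]) \<longleftrightarrow>
     k \<in> occs T P \<and> k + length P < length T \<and> T ! (k + length P) = y"
proof (cases "k + length P < length T")
  case True
  then show ?thesis
    by (auto simp: occs_def take_Suc_conv_app_nth)
next
  case False
  then show ?thesis
    using occs_length[of k T "P @ [y]"] by auto
qed

text \<open>For empty \<open>P\<close> the direction from left to right fails at the last letter of
  the text: \<open>Suc k\<close> would be \<open>length T\<close>, where no occurrence may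
  start.\<close>

lemma occs_Cons:
  assumes "P \<noteq> []"
  shows "k \<in> occs T (x # P) \<longleftrightarrow> k < length T \<and> T ! k = x \<and> Suc k \<in> occs T P"
proof (cases "k < length T")
  case True
  then have "drop k T = T ! k # drop (Suc k) T"
    by (simp add: Cons_nth_drop_Suc)
  moreover have "Suc k < length T" if "take (length P) (drop (Suc k) T) = P"
    using arg_cong[OF that, of length] assms by (cases P) auto
  ultimately show ?thesis
    using True by (auto simp: occs_def)
qed (auto simp: occs_def)

text \<open>This direction holds for empty \<open>S\<close> too, a case that
  \<open>occs_Cons\<close> excludes but the theorem covers.\<close>

lemma occs_Cons_pred:
  assumes "k \<in> occs T S" and "k \<noteq> 0"
  shows "k - 1 \<in> occs T (T ! (k - 1) # S)"
proof -
  obtain l where l: "k = Suc l"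
    using assms(2) by (cases k) auto
  then have "drop l T = T ! l # drop (Suc l) T"
    using assms(1) by (simp add: occs_def Cons_nth_drop_Suc)
  then show ?thesis
    using assms(1) l by (auto simp: occs_def)
qed

text \<open>Occurrences start inside the text, so one that reaches its end is nonempty and ends with
  the sentinel. Every other occurrence then also ends with the sentinel, hence at the same place,
  and \<open>S\<close> would be unique.\<close>

lemma repeated_not_at_end:
  assumes "last T = d" and "d \<notin> set (butlast T)" and "repeated T S" and "k \<in> occs T S"
  shows "k + length S < length T"
proof (rule ccontr)
  assume "\<not> k + length S < length T"
  then have end_S: "k + length S = length T"
    using occs_length[OF assms(4)] by simp
  have "k < length T"
    using assms(4) by (simp add: occs_def)
  then have "T \<noteq> []" and "S \<noteq> []"
    using end_S by auto
  then obtain P y where S: "S = P @ [y]"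
    by (cases S rule: rev_cases) auto
  have y: "y = d"
  proof -
    have "k + length P = length T - 1"
      using end_S unfolding S by simp
    moreover have "T ! (k + length P) = y"
      using assms(4) unfolding S occs_snoc by blast
    ultimately show ?thesis
      using assms(1) last_conv_nth[OF \<open>T \<noteq> []\<close>] by simp
  qed
  have "l = k" if "l \<in> occs T S" for l
  proof -
    have l: "l + length P < length T" "T ! (l + length P) = d"
      using that by (auto simp: S y occs_snoc)
    have "\<not> l + length P < length T - 1"
      using l assms(2) by (auto simp: in_set_conv_nth nth_butlast)
    then show ?thesis
      using l(1) end_S by (simp add: S)
  qed
  then have "occs T S = {k}"
    using assms(4) by blast
  then have "uniq T S"
    unfolding uniq_iff by blast
  then show False
    using assms(3) repeated_iff_not_uniq[OF assms(4)] by blast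
qed

text \<open>A repeated \<open>S\<close> never ends the text, so the convention for
  \<open>j = length T\<close> never applies and a next letter always exists. Only the convention for
  \<open>i = 1\<close> survives, as \<open>k = 0\<close>.\<close>

lemma net_occurrence_iff:
  assumes "last T = d" and "d \<notin> set (butlast T)" and "repeated T S"
  shows "net_occurrence T i j \<and> substr T i j = S \<longleftrightarrow>
    (\<exists>k. i = Suc k \<and> j = k + length S \<and> k \<in> occs T S \<and> k + length S < length T \<and>
      (k = 0 \<or> uniq T (T ! (k - 1) # S)) \<and> uniq T (S @ [T ! (k + length S)]))"
proof -
  have exts: "substr T (Suc k) (k + length S) = S"
    "k \<noteq> 0 \<Longrightarrow> substr T k (k + length S) = T ! (k - 1) # S"
    "substr T (Suc k) (Suc (k + length S)) = S @ [T ! (k + length S)]"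
    if "k \<in> occs T S" "k + length S < length T" for k
  proof -
    show "substr T (Suc k) (k + length S) = S"
      using that by (simp add: substr_Suc occs_def)
    show "substr T k (k + length S) = T ! (k - 1) # S" if "k \<noteq> 0"
      using occs_Cons_pred[OF \<open>k \<in> occs T S\<close> that] that
      by (cases k) (simp_all add: substr_Suc occs_def)
    have "k \<in> occs T (S @ [T ! (k + length S)])"
      using that by (simp add: occs_snoc)
    then show "substr T (Suc k) (Suc (k + length S)) = S @ [T ! (k + length S)]"
      by (simp add: substr_Suc occs_def Suc_diff_le)
  qed
  show ?thesis
  proof
    assume net: "net_occurrence T i j \<and> substr T i j = S"
    then obtain k where i: "i = Suc k"
      by (cases i) (auto simp: net_occurrence_def)
    have k: "k < length T" "k \<le> j" "j \<le> length T" "take (j - k) (drop k T) = S"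
      using net by (auto simp: i net_occurrence_def substr_Suc)
    then have "length S = j - k"
      by auto
    then have j: "j = k + length S"
      using k by simp
    have occ: "k \<in> occs T S"
      using k by (simp add: occs_def j)
    moreover have lt: "k + length S < length T"
      using repeated_not_at_end[OF assms occ] .
    moreover have "k = 0 \<or> uniq T (T ! (k - 1) # S)"
      using net exts(2)[OF occ lt] by (cases "k = 0") (simp_all add: i j net_occurrence_def)
    moreover have "uniq T (S @ [T ! (k + length S)])"
      using net exts(3)[OF occ lt] lt by (auto simp: i j net_occurrence_def)
    ultimately show "\<exists>k. i = Suc k \<and> j = k + length S \<and> k \<in> occs T S \<and>
      k + length S < length T \<and> (k = 0 \<or> uniq T (T ! (k - 1) # S)) \<and>
      uniq T (S @ [T ! (k + length S)])"
      using i j by blast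
  next
    assume "\<exists>k. i = Suc k \<and> j = k + length S \<and> k \<in> occs T S \<and> k + length S < length T \<and>
      (k = 0 \<or> uniq T (T ! (k - 1) # S)) \<and> uniq T (S @ [T ! (k + length S)])"
    then obtain k where "i = Suc k" "j = k + length S" "k \<in> occs T S" "k + length S < length T"
      "k = 0 \<or> uniq T (T ! (k - 1) # S)" "uniq T (S @ [T ! (k + length S)])"
      by blast
    then show "net_occurrence T i j \<and> substr T i j = S"
      using exts[of k] assms(3) by (cases "k = 0") (simp_all add: net_occurrence_def)
  qed
qed

theorem theorem2:
  fixes \<Sigma> :: "'a set" and d :: 'a and T S :: "'a list"
  assumes "finite \<Sigma>" and "d \<notin> \<Sigma>"
    and "set T \<subseteq> \<Sigma> \<union> {d}"
    and "T \<noteq> []" and "last T = d" and "d \<notin> set (butlast T)"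
    and "repeated T S"
  shows "int (net_frequency T S) =
    int (card (unique_right_exts \<Sigma> d T S)) -
    (\<Sum>x\<in>repeated_left_exts \<Sigma> T S.
       int (card (unique_right_exts \<Sigma> d T (x # S) \<inter> unique_right_exts \<Sigma> d T S)))"
proof -
  let ?R = "unique_right_exts \<Sigma> d T"
  let ?L = "repeated_left_exts \<Sigma> T S"
  let ?N = "{(i, j). net_occurrence T i j \<and> substr T i j = S}"
  let ?U = "\<Union>x\<in>?L. ?R (x # S) \<inter> ?R S"
  have fin_L: "finite ?L" and fin_R: "finite (?R P)" for P
    using assms(1) by (auto simp: repeated_left_exts_def unique_right_exts_def)
  have same: "k = l" if "y \<in> ?R S" "k \<in> occs T (S @ [y])" "l \<in> occs T (S @ [y])" for y k l
    using that by (auto simp: unique_right_exts_def uniq_iff)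
  have left: "\<exists>k. Suc k \<in> occs T (S @ [y]) \<and> T ! k = x" if "y \<in> ?R (x # S)" for x y
  proof -
    have "uniq T (x # (S @ [y]))"
      using that by (simp add: unique_right_exts_def)
    then obtain k where "occs T (x # (S @ [y])) = {k}"
      unfolding uniq_iff by blast
    then show ?thesis
      using occs_Cons[of "S @ [y]" k T x] by blast
  qed
  \<comment> \<open>Both \<open>x\<close> and \<open>x'\<close> would stand just before the only
    occurrence of \<open>S @ [y]\<close>.\<close>
  have disj: "(?R (x # S) \<inter> ?R S) \<inter> (?R (x' # S) \<inter> ?R S) = {}" if "x \<noteq> x'" for x x'
  proof (rule ccontr)
    assume "\<not> ?thesis"
    then obtain y where y: "y \<in> ?R (x # S)" "y \<in> ?R (x' # S)" "y \<in> ?R S"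
      by blast
    from left[OF y(1)] left[OF y(2)] obtain k l
      where "Suc k \<in> occs T (S @ [y])" "T ! k = x" "Suc l \<in> occs T (S @ [y])" "T ! l = x'"
      by blast
    then show False
      using same[OF y(3)] \<open>x \<noteq> x'\<close> by blast
  qed
  \<comment> \<open>\<open>T ! j\<close> counts from 0 while \<open>j\<close> counts from 1, so it
    is the letter just after the occurrence.\<close>
  have bij: "bij_betw (\<lambda>(i, j). T ! j) ?N (?R S - ?U)"
  proof (intro bij_betw_imageI inj_onI equalityI subsetI)
    fix p q
    assume "p \<in> ?N" "q \<in> ?N" and eq: "(case p of (i, j) \<Rightarrow> T ! j) = (case q of (i, j) \<Rightarrow> T ! j)"
    then obtain k l
      where k: "p = (Suc k, k + length S)" "k \<in> occs T S" "k + length S < length T"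
        "uniq T (S @ [T ! (k + length S)])"
      and l: "q = (Suc l, l + length S)" "l \<in> occs T S" "l + length S < length T"
      using net_occurrence_iff[OF assms(5-7)] by auto
    then have "k \<in> occs T (S @ [T ! (k + length S)])" "l \<in> occs T (S @ [T ! (k + length S)])"
      using eq by (auto simp: occs_snoc)
    then have "k = l"
      using k(4) by (auto simp: uniq_iff)
    then show "p = q"
      using k l by simp
  next
    fix y
    assume "y \<in> (\<lambda>(i, j). T ! j) ` ?N"
    then obtain k where y: "y = T ! (k + length S)"
      and k: "k \<in> occs T S" "k + length S < length T"
        "k = 0 \<or> uniq T (T ! (k - 1) # S)" "uniq T (S @ [y])"
      using net_occurrence_iff[OF assms(5-7)] by auto
    have R: "y \<in> ?R S"
      using k(4) subsetD[OF assms(3) nth_mem[OF k(2)]] by (simp add: unique_right_exts_def y)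
    moreover have "y \<notin> ?R (x # S)" if "x \<in> ?L" for x
    proof
      assume "y \<in> ?R (x # S)"
      then obtain l where l: "Suc l \<in> occs T (S @ [y])" "T ! l = x"
        using left by blast
      \<comment> \<open>The net occurrence is thus preceded by \<open>x\<close>, and being net makes
        \<open>x # S\<close> unique, against \<open>x\<close> lying in \<open>?L\<close>.\<close>
      have "k = Suc l"
        using same[OF R _ l(1)] k y by (simp add: occs_snoc)
      then have "uniq T (x # S)"
        using k(3) l(2) by simp
      then show False
        using that by (simp add: repeated_left_exts_def repeated_def uniq_def)
    qed
    ultimately show "y \<in> ?R S - ?U"
      by blast
  next
    fix y
    assume y: "y \<in> ?R S - ?U"
    then obtain k where occ: "occs T (S @ [y]) = {k}"
      by (auto simp: unique_right_exts_def uniq_iff)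
    then have k: "k \<in> occs T S" "k + length S < length T" "T ! (k + length S) = y"
      using occs_snoc[of k T S y] by auto
    have "uniq T (T ! (k - 1) # S)" if "k \<noteq> 0"
    proof (rule ccontr)
      assume not_uniq: "\<not> uniq T (T ! (k - 1) # S)"
      let ?x = "T ! (k - 1)"
      \<comment> \<open>The preceding letter is not the last one of the text, hence not the
        sentinel; this puts it in \<Sigma>, as membership in \<open>?L\<close> demands.\<close>
      have lt: "k - 1 < length T - 1"
        using k that by linarith
      then have "?x \<in> set (butlast T)"
        using nth_mem[of "k - 1" "butlast T"] by (simp add: nth_butlast)
      then have "?x \<in> \<Sigma>"
        using assms(3,6) in_set_butlastD by fastforce
      then have L: "?x \<in> ?L"
        using repeated_iff_not_uniq[OF occs_Cons_pred[OF k(1) that]] not_uniq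
        by (simp add: repeated_left_exts_def)
      \<comment> \<open>Dropping the first letter turns any occurrence of this string into one of
        \<open>S @ [y]\<close>, and \<open>k\<close> is the only one.\<close>
      have "occs T (?x # (S @ [y])) = {k - 1}"
        using occs_Cons[of "S @ [y]"] occ that lt by auto
      then have "y \<in> ?R (?x # S)"
        using y by (auto simp: unique_right_exts_def uniq_iff)
      then show False
        using y L by blast
    qed
    then have "(Suc k, k + length S) \<in> ?N"
      using net_occurrence_iff[OF assms(5-7), of "Suc k" "k + length S"] k occ
      by (auto simp: uniq_iff)
    then show "y \<in> (\<lambda>(i, j). T ! j) ` ?N"
      using k(3) by (intro rev_image_eqI[of "(Suc k, k + length S)"]) simp_all
  qed
  have "card ?U = (\<Sum>x\<in>?L. card (?R (x # S) \<inter> ?R S))"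
    using fin_L fin_R disj by (intro card_UN_disjoint) auto
  \<comment> \<open>The inclusion also gives \<open>card ?U \<le> card (?R S)\<close>, so
    subtraction on naturals agrees with that on integers.\<close>
  moreover have "?U \<subseteq> ?R S"
    by blast
  then have "card (?R S - ?U) = card (?R S) - card ?U" "card ?U \<le> card (?R S)"
    using fin_R by (simp_all add: card_Diff_subset finite_subset card_mono)
  ultimately show ?thesis
    using bij_betw_same_card[OF bij] by (simp add: net_frequency_def of_nat_diff)
qed

end
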